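(* Let $X$ be an object in a category $\mathcal{C}$ with finite products. There is a sub-operad $\mathcal{L}$ of the endomorphism set operad $\mathcal{E}$ of $X$ such that $\mathcal{L}(d)=\mathcal{L}_{\mathcal{C}}(X^d,X)$ for all positive integers $d$. In particular, for any positive integers $d$, $e$, $i$ such that $1\le i\le d$, and any morphisms $f\in\mathcal{L}_{\mathcal{C}}(X^d,X)$ and $g\in\mathcal{L}_{\mathcal{C}}(X^e,X)$, we have $f\circ_i g\in\mathcal{L}_{\mathcal{C}}(X^{d+e-1},X)$.
   Context: Categories are assumed to be essentially small. For a positive integer $d$, $X^d$ is the product of $d$ copies of $X$ in $\mathcal{C}$, with canonical projections $\pi^d_i : X^d\to X$, $1\le i\le d$. A morphism $\eta:Y\to X^d$ with components $\eta_i=\pi^d_i\circ\eta$ is written $(\eta_i)_{1\le i\le d}$. For $1\le s\le d+1$, $\tau^{d+1}_s=(\pi^{d+1}_1,\dots,\pi^{d+1}_{s-1},\pi^{d+1}_{s+1},\dots,\pi^{d+1}_{d+1}) : X^{d+1}\to X^d$ is the morphism discarding coordinate $s$. A Latin hypercube of dimension $d$ over $X$ is a morphism $\lambda:L\to X^{d+1}$ in $\mathcal{C}$ such that $\tau^{d+1}_s\circ\lambda:L\to X^d$ is an isomorphism for all $1\le s\le d+1$. $\mathcal{L}_{\mathcal{C}}(X^d,X)$ is the subset of $\mathrm{Hom}_{\mathcal{C}}(X^d,X)$ of all morphisms $f$ such that $(\mathrm{Id}_{X^d},f):X^d\to X^d\times X=X^{d+1}$ is a Latin hypercube. The endomorphism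 set operad $\mathcal{E}$ of $X$ consists of the sets $\mathcal{E}(n)=\mathrm{Hom}_{\mathcal{C}}(X^n,X)$, $n\ge 1$, with the action of the symmetric group $\mathfrak{S}_n$ on $\mathcal{E}(n)$ induced by permuting the coordinates of $X^n$ (where $\sigma\in\mathfrak{S}_n$ induces the automorphism $\hat\sigma$ of $X^n$ with $\pi^n_i\circ\hat\sigma=\pi^n_{\sigma^{-1}(i)}$), the unit element $\mathrm{Id}_X\in\mathcal{E}(1)$, and the structural maps $-\circ_i-:\mathrm{Hom}_{\mathcal{C}}(X^d,X)\times\mathrm{Hom}_{\mathcal{C}}(X^e,X)\to\mathrm{Hom}_{\mathcal{C}}(X^{d+e-1},X)$, for $1\le i\le d$, given by $$f\circ_i g=f\circ(\mathrm{Id}_{X^{i-1}}\times g\times\mathrm{Id}_{X^{d-i}}),$$ with the identifications $X^{i-1}\times X^e\times X^{d-i}=X^{d+e-1}$ and $X^{i-1}\times X\times X^{d-i}=X^d$. A sub-operad of $\mathcal{E}$ is a family of subsets $\mathcal{L}(n)\subseteq\mathcal{E}(n)$, $n\ge1$, containing the unit element, stable under the symmetric group actions, and closed under all the maps $-\circ_i-$. *)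

theory Defs
  imports "HOL-Combinatorics.Permutations"
begin

section \<open>Categories with finite products\<close>

record ('o, 'm) cat =
  Ob :: "'o set"
  Mor :: "'m set"
  Dom :: "'m \<Rightarrow> 'o"
  Cod :: "'m \<Rightarrow> 'o"
  Idt :: "'o \<Rightarrow> 'm"
  Cmp :: "'m \<Rightarrow> 'm \<Rightarrow> 'm" (infixr "\<cdot>\<index>" 55)

definition hom :: "('o, 'm) cat \<Rightarrow> 'o \<Rightarrow> 'o \<Rightarrow> 'm set" where
  "hom C a b = {f \<in> Mor C. Dom C f = a \<and> Cod C f = b}"

locale category =
  fixes C :: "('o, 'm) cat"
  assumes dom_ob: "f \<in> Mor C \<Longrightarrow> Dom C f \<in> Ob C"
    and cod_ob: "f \<in> Mor C \<Longrightarrow> Cod C f \<in> Ob C"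
    and id_hom: "a \<in> Ob C \<Longrightarrow> Idt C a \<in> hom C a a"
    and comp_hom: "f \<in> hom C a b \<Longrightarrow> g \<in> hom C b c \<Longrightarrow> g \<cdot>\<^bsub>C\<^esub> f \<in> hom C a c"
    and comp_id: "f \<in> hom C a b \<Longrightarrow> f \<cdot>\<^bsub>C\<^esub> Idt C a = f"
    and id_comp: "f \<in> hom C a b \<Longrightarrow> Idt C b \<cdot>\<^bsub>C\<^esub> f = f"
    and comp_assoc: "f \<in> hom C a b \<Longrightarrow> g \<in> hom C b c \<Longrightarrow> h \<in> hom C c d \<Longrightarrow>
      (h \<cdot>\<^bsub>C\<^esub> g) \<cdot>\<^bsub>C\<^esub> f = h \<cdot>\<^bsub>C\<^esub> (g \<cdot>\<^bsub>C\<^esub> f)"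

definition is_iso :: "('o, 'm) cat \<Rightarrow> 'm \<Rightarrow> bool" where
  "is_iso C f \<longleftrightarrow> f \<in> Mor C \<and>
     (\<exists>g \<in> hom C (Cod C f) (Dom C f).
        g \<cdot>\<^bsub>C\<^esub> f = Idt C (Dom C f) \<and> f \<cdot>\<^bsub>C\<^esub> g = Idt C (Cod C f))"

definition is_product ::
    "('o, 'm) cat \<Rightarrow> 'i set \<Rightarrow> ('i \<Rightarrow> 'o) \<Rightarrow> 'o \<Rightarrow> ('i \<Rightarrow> 'm) \<Rightarrow> bool" where
  "is_product C I A P p \<longleftrightarrow> P \<in> Ob C \<and> (\<forall>i\<in>I. p i \<in> hom C P (A i)) \<and>
     (\<forall>Q\<in>Ob C. \<forall>q. (\<forall>i\<in>I. q i \<in> hom C Q (A i)) \<longrightarrow>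
        (\<exists>!h. h \<in> hom C Q P \<and> (\<forall>i\<in>I. p i \<cdot>\<^bsub>C\<^esub> h = q i)))"

definition has_finite_products :: "('o, 'm) cat \<Rightarrow> bool" where
  "has_finite_products C \<longleftrightarrow>
     (\<forall>(I :: nat set) A. finite I \<longrightarrow> A ` I \<subseteq> Ob C \<longrightarrow> (\<exists>P p. is_product C I A P p))"

text \<open>The morphism \<open>Q \<rightarrow> P\<close> with components \<open>q i\<close>, where \<open>P\<close> is a product with projections \<open>p i\<close>
  (the factors are determined by the codomains of the \<open>p i\<close>).\<close>

definition tuple :: "('o, 'm) cat \<Rightarrow> 'i set \<Rightarrow> 'o \<Rightarrow> ('i \<Rightarrow> 'm) \<Rightarrow> 'o \<Rightarrow> ('i \<Rightarrow> 'm) \<Rightarrow> 'm" where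
  "tuple C I P p Q q = (THE h. h \<in> hom C Q P \<and> (\<forall>i\<in>I. p i \<cdot>\<^bsub>C\<^esub> h = q i))"

text \<open>The product of the morphisms \<open>h i\<close>, from a product \<open>Q\<close> with projections \<open>q i\<close> to a product
  \<open>P\<close> with projections \<open>p i\<close>.\<close>

definition prod_mor ::
    "('o, 'm) cat \<Rightarrow> 'i set \<Rightarrow> 'o \<Rightarrow> ('i \<Rightarrow> 'm) \<Rightarrow> 'o \<Rightarrow> ('i \<Rightarrow> 'm) \<Rightarrow> ('i \<Rightarrow> 'm) \<Rightarrow> 'm" where
  "prod_mor C I Q q P p h = tuple C I P p Q (\<lambda>i. h i \<cdot>\<^bsub>C\<^esub> q i)"

section \<open>Powers of an object\<close>

text \<open>A choice of the powers \<open>X\<^sup>d\<close> (object \<open>pw d\<close>) with canonical projections \<open>pr d 1, \<dots>, pr d d\<close>.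
  Here \<open>X\<^sup>0\<close> is a terminal object; it occurs as a factor in the partial compositions. The product of
  one copy of \<open>X\<close> is \<open>X\<close> itself, so that \<open>Id\<^sub>X\<close> lies in \<open>Hom(X\<^sup>1, X)\<close>.\<close>

definition is_powers :: "('o, 'm) cat \<Rightarrow> 'o \<Rightarrow> (nat \<Rightarrow> 'o) \<Rightarrow> (nat \<Rightarrow> nat \<Rightarrow> 'm) \<Rightarrow> bool" where
  "is_powers C X pw pr \<longleftrightarrow>
     (\<forall>d. is_product C {1..d} (\<lambda>_. X) (pw d) (pr d)) \<and> pw 1 = X \<and> pr 1 1 = Idt C X"

text \<open>The morphism \<open>\<tau>\<^sub>s : X\<^bsup>d+1\<^esup> \<rightarrow> X\<^sup>d\<close> discarding coordinate \<open>s\<close>.\<close>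

definition discard ::
    "('o, 'm) cat \<Rightarrow> (nat \<Rightarrow> 'o) \<Rightarrow> (nat \<Rightarrow> nat \<Rightarrow> 'm) \<Rightarrow> nat \<Rightarrow> nat \<Rightarrow> 'm" where
  "discard C pw pr d s =
     tuple C {1..d} (pw d) (pr d) (pw (d + 1)) (\<lambda>j. pr (d + 1) (if j < s then j else j + 1))"

text \<open>The morphism \<open>X\<^sup>n \<rightarrow> X\<^sup>k\<close> with components the coordinates \<open>a+1, \<dots>, a+k\<close>. These are the projections
  that exhibit \<open>X\<^sup>n\<close> as a product of powers of \<open>X\<close> in the identifications
  \<open>X\<^bsup>i-1\<^esup> \<times> X\<^sup>e \<times> X\<^bsup>d-i\<^esup> = X\<^bsup>d+e-1\<^esup>\<close> and \<open>X\<^bsup>i-1\<^esup> \<times> X \<times> X\<^bsup>d-i\<^esup> = X\<^sup>d\<close>; see \<open>blocks_product\<close> below.\<close>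

definition block ::
    "('o, 'm) cat \<Rightarrow> (nat \<Rightarrow> 'o) \<Rightarrow> (nat \<Rightarrow> nat \<Rightarrow> 'm) \<Rightarrow> nat \<Rightarrow> nat \<Rightarrow> nat \<Rightarrow> 'm" where
  "block C pw pr n a k = tuple C {1..k} (pw k) (pr k) (pw n) (\<lambda>j. pr n (a + j))"

section \<open>Latin hypercubes\<close>

definition latin_hypercube ::
    "('o, 'm) cat \<Rightarrow> (nat \<Rightarrow> 'o) \<Rightarrow> (nat \<Rightarrow> nat \<Rightarrow> 'm) \<Rightarrow> nat \<Rightarrow> 'm \<Rightarrow> bool" where
  "latin_hypercube C pw pr d l \<longleftrightarrow> l \<in> Mor C \<and> Cod C l = pw (d + 1) \<and>
     (\<forall>s\<in>{1..d + 1}. is_iso C (discard C pw pr d s \<cdot>\<^bsub>C\<^esub> l))"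

text \<open>The morphism \<open>(Id, f) : X\<^sup>d \<rightarrow> X\<^sup>d \<times> X = X\<^bsup>d+1\<^esup>\<close>; the projections of \<open>X\<^bsup>d+1\<^esup>\<close> onto the two factors
  are \<open>(\<pi>\<^sub>1, \<dots>, \<pi>\<^sub>d)\<close> and \<open>\<pi>\<^bsub>d+1\<^esub>\<close>.\<close>

definition graph_mor ::
    "('o, 'm) cat \<Rightarrow> (nat \<Rightarrow> 'o) \<Rightarrow> (nat \<Rightarrow> nat \<Rightarrow> 'm) \<Rightarrow> nat \<Rightarrow> 'm \<Rightarrow> 'm" where
  "graph_mor C pw pr d f =
     tuple C {..<2::nat} (pw (d + 1)) (\<lambda>j. [block C pw pr (d + 1) 0 d, pr (d + 1) (d + 1)] ! j)
       (pw d) (\<lambda>j. [Idt C (pw d), f] ! j)"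

definition latin_maps ::
    "('o, 'm) cat \<Rightarrow> 'o \<Rightarrow> (nat \<Rightarrow> 'o) \<Rightarrow> (nat \<Rightarrow> nat \<Rightarrow> 'm) \<Rightarrow> nat \<Rightarrow> 'm set" where
  "latin_maps C X pw pr d =
     {f \<in> hom C (pw d) X. latin_hypercube C pw pr d (graph_mor C pw pr d f)}"

section \<open>The endomorphism operad\<close>

text \<open>\<open>pcomp E d e i f g\<close> is \<open>f \<circ>\<^sub>i g\<close> for \<open>f\<close> of arity \<open>d\<close> and \<open>g\<close> of arity \<open>e\<close>. Only arities \<open>\<ge> 1\<close> are
  meaningful.\<close>

record 'm operad_data =
  ops :: "nat \<Rightarrow> 'm set"
  act :: "nat \<Rightarrow> (nat \<Rightarrow> nat) \<Rightarrow> 'm \<Rightarrow> 'm"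
  opunit :: 'm
  pcomp :: "nat \<Rightarrow> nat \<Rightarrow> nat \<Rightarrow> 'm \<Rightarrow> 'm \<Rightarrow> 'm"

definition suboperad :: "'m operad_data \<Rightarrow> (nat \<Rightarrow> 'm set) \<Rightarrow> bool" where
  "suboperad E L \<longleftrightarrow>
     (\<forall>n\<ge>1. L n \<subseteq> ops E n) \<and>
     opunit E \<in> L 1 \<and>
     (\<forall>n\<ge>1. \<forall>\<sigma>. \<sigma> permutes {1..n} \<longrightarrow> (\<forall>f\<in>L n. act E n \<sigma> f \<in> L n)) \<and>
     (\<forall>d\<ge>1. \<forall>e\<ge>1. \<forall>i\<in>{1..d}. \<forall>f\<in>L d. \<forall>g\<in>L e. pcomp E d e i f g \<in> L (d + e - 1))"

text \<open>The automorphism of \<open>X\<^sup>n\<close> whose \<open>i\<close>-th component is \<open>\<pi>\<^bsub>\<sigma>\<^sup>-\<^sup>1(i)\<^esub>\<close>.\<close>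

definition perm_mor ::
    "('o, 'm) cat \<Rightarrow> (nat \<Rightarrow> 'o) \<Rightarrow> (nat \<Rightarrow> nat \<Rightarrow> 'm) \<Rightarrow> nat \<Rightarrow> (nat \<Rightarrow> nat) \<Rightarrow> 'm" where
  "perm_mor C pw pr n \<sigma> = tuple C {1..n} (pw n) (pr n) (pw n) (\<lambda>i. pr n (inv \<sigma> i))"

text \<open>\<open>Id \<times> g \<times> Id : X\<^bsup>i-1\<^esup> \<times> X\<^sup>e \<times> X\<^bsup>d-i\<^esup> \<rightarrow> X\<^bsup>i-1\<^esup> \<times> X \<times> X\<^bsup>d-i\<^esup>\<close>\<close>

definition insert_mor ::
    "('o, 'm) cat \<Rightarrow> (nat \<Rightarrow> 'o) \<Rightarrow> (nat \<Rightarrow> nat \<Rightarrow> 'm) \<Rightarrow> nat \<Rightarrow> nat \<Rightarrow> nat \<Rightarrow> 'm \<Rightarrow> 'm" where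
  "insert_mor C pw pr d e i g =
     prod_mor C {..<3::nat}
       (pw (d + e - 1))
       (\<lambda>j. [block C pw pr (d + e - 1) 0 (i - 1),
             block C pw pr (d + e - 1) (i - 1) e,
             block C pw pr (d + e - 1) (i - 1 + e) (d - i)] ! j)
       (pw d)
       (\<lambda>j. [block C pw pr d 0 (i - 1), pr d i, block C pw pr d i (d - i)] ! j)
       (\<lambda>j. [Idt C (pw (i - 1)), g, Idt C (pw (d - i))] ! j)"

text \<open>\<open>\<sigma>\<close> acts by precomposition with the automorphism above, which is a right action. Stability of a
  family of subsets does not depend on whether \<open>\<sigma>\<close> or its inverse is used.\<close>

definition endo_operad ::
    "('o, 'm) cat \<Rightarrow> 'o \<Rightarrow> (nat \<Rightarrow> 'o) \<Rightarrow> (nat \<Rightarrow> nat \<Rightarrow> 'm) \<Rightarrow> 'm operad_data" where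
  "endo_operad C X pw pr =
     \<lparr>ops = (\<lambda>n. hom C (pw n) X),
      act = (\<lambda>n \<sigma> f. f \<cdot>\<^bsub>C\<^esub> perm_mor C pw pr n \<sigma>),
      opunit = Idt C X,
      pcomp = (\<lambda>d e i f g. f \<cdot>\<^bsub>C\<^esub> insert_mor C pw pr d e i g)\<rparr>"

section \<open>Well-definedness\<close>

lemma tuple_props:
  assumes "is_product C I A P p" "Q \<in> Ob C" "\<And>i. i \<in> I \<Longrightarrow> q i \<in> hom C Q (A i)"
  shows "tuple C I P p Q q \<in> hom C Q P"
    and "i \<in> I \<Longrightarrow> p i \<cdot>\<^bsub>C\<^esub> tuple C I P p Q q = q i"
proof -
  have "\<exists>!h. h \<in> hom C Q P \<and> (\<forall>i\<in>I. p i \<cdot>\<^bsub>C\<^esub> h = q i)"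
    using assms unfolding is_product_def by blast
  from theI'[OF this] show "tuple C I P p Q q \<in> hom C Q P"
    and "i \<in> I \<Longrightarrow> p i \<cdot>\<^bsub>C\<^esub> tuple C I P p Q q = q i"
    unfolding tuple_def by blast+
qed

lemma product_eqI:
  assumes "is_product C I A P p" "category C" "h \<in> hom C Q P" "k \<in> hom C Q P"
    "\<And>i. i \<in> I \<Longrightarrow> p i \<cdot>\<^bsub>C\<^esub> h = p i \<cdot>\<^bsub>C\<^esub> k"
  shows "h = k"
proof -
  interpret category C by fact
  have Q: "Q \<in> Ob C" using assms(3) dom_ob unfolding hom_def by blast
  have "\<forall>i\<in>I. p i \<cdot>\<^bsub>C\<^esub> k \<in> hom C Q (A i)"
    using assms(1,4) comp_hom unfolding is_product_def by blast
  then have "\<exists>!h. h \<in> hom C Q P \<and> (\<forall>i\<in>I. p i \<cdot>\<^bsub>C\<^esub> h = p i \<cdot>\<^bsub>C\<^esub> k)"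
    using assms(1) Q unfolding is_product_def by simp
  then obtain l where l: "\<And>m. m \<in> hom C Q P \<and> (\<forall>i\<in>I. p i \<cdot>\<^bsub>C\<^esub> m = p i \<cdot>\<^bsub>C\<^esub> k) \<Longrightarrow> m = l"
    by (elim ex1E) blast
  have "h = l" using assms(3,5) by (intro l) simp
  moreover have "k = l" using assms(4) by (intro l) simp
  ultimately show ?thesis by simp
qed

lemma powers_exist:
  assumes "category C" "has_finite_products C" "X \<in> Ob C"
  shows "\<exists>pw pr. is_powers C X pw pr"
proof -
  interpret category C by fact
  have one: "is_product C {1..1::nat} (\<lambda>_. X) X (\<lambda>_. Idt C X)"
  proof -
    have "\<exists>!h. h \<in> hom C Q X \<and> (\<forall>i\<in>{1..1::nat}. Idt C X \<cdot>\<^bsub>C\<^esub> h = q i)"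
      if "\<forall>i\<in>{1..1::nat}. q i \<in> hom C Q X" for Q q
      using that id_comp[of _ Q X] by (intro ex1I[of _ "q 1"]) auto
    then show ?thesis
      unfolding is_product_def using assms(3) id_hom by blast
  qed
  have "\<exists>P p. is_product C {1..d} (\<lambda>_. X) P p \<and> (d = 1 \<longrightarrow> P = X \<and> p 1 = Idt C X)" for d :: nat
  proof (cases "d = 1")
    case True
    then show ?thesis using one by blast
  next
    case False
    have "\<exists>P p. is_product C {1..d} (\<lambda>_. X) P p"
      using assms(2,3) unfolding has_finite_products_def by (simp add: image_subset_iff)
    then show ?thesis using False by blast
  qed
  then obtain pw pr where "\<And>d::nat. is_product C {1..d} (\<lambda>_. X) (pw d) (pr d) \<and>
      (d = 1 \<longrightarrow> pw d = X \<and> pr d 1 = Idt C X)" by metis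
  then show ?thesis unfolding is_powers_def by blast
qed

lemma block_props:
  assumes "category C" "is_powers C X pw pr" "a + k \<le> n"
  shows "block C pw pr n a k \<in> hom C (pw n) (pw k)"
    and "j \<in> {1..k} \<Longrightarrow> pr k j \<cdot>\<^bsub>C\<^esub> block C pw pr n a k = pr n (a + j)"
proof -
  have n: "is_product C {1..n} (\<lambda>_. X) (pw n) (pr n)"
    and k: "is_product C {1..k} (\<lambda>_. X) (pw k) (pr k)"
    using assms(2) unfolding is_powers_def by auto
  have c: "pw n \<in> Ob C" "\<And>j. j \<in> {1..k} \<Longrightarrow> pr n (a + j) \<in> hom C (pw n) X"
    using n assms(3) unfolding is_product_def by auto
  show "block C pw pr n a k \<in> hom C (pw n) (pw k)"
    and "j \<in> {1..k} \<Longrightarrow> pr k j \<cdot>\<^bsub>C\<^esub> block C pw pr n a k = pr n (a + j)"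
    unfolding block_def using tuple_props[OF k c(1), of "\<lambda>j. pr n (a + j)"] c(2) by simp_all
qed

lemma block_one:
  assumes "category C" "is_powers C X pw pr" "a < n"
  shows "block C pw pr n a 1 = pr n (a + 1)"
proof -
  interpret category C by fact
  have h: "block C pw pr n a 1 \<in> hom C (pw n) X"
    using block_props(1)[OF assms(1,2), of a 1 n] assms unfolding is_powers_def by simp
  have "pr 1 1 \<cdot>\<^bsub>C\<^esub> block C pw pr n a 1 = pr n (a + 1)"
    using block_props(2)[OF assms(1,2), of a 1 n 1] assms by simp
  then show ?thesis using h assms(2) id_comp unfolding is_powers_def by simp
qed

lemma blocks_product:
  assumes "category C" "is_powers C X pw pr"
  shows "is_product C {..<3::nat} (\<lambda>j. [pw a, pw b, pw c] ! j) (pw (a + b + c))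
    (\<lambda>j. [block C pw pr (a + b + c) 0 a, block C pw pr (a + b + c) a b,
          block C pw pr (a + b + c) (a + b) c] ! j)"
    (is "is_product C _ ?A ?P ?p")
proof -
  interpret category C by fact
  note One_nat_def [simp del]
  let ?n = "a + b + c"
  have pow: "is_product C {1..d} (\<lambda>_. X) (pw d) (pr d)" for d
    using assms(2) unfolding is_powers_def by auto
  have I: "{..<3::nat} = {0, 1, 2}" by auto
  have h0: "block C pw pr ?n 0 a \<in> hom C ?P (pw a)"
    and h1: "block C pw pr ?n a b \<in> hom C ?P (pw b)"
    and h2: "block C pw pr ?n (a + b) c \<in> hom C ?P (pw c)"
    by (rule block_props(1)[OF assms]; simp)+
  have prh: "j \<in> {1..d} \<Longrightarrow> pr d j \<in> hom C (pw d) X" for d j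
    using pow[of d] unfolding is_product_def by blast
  have "\<exists>!h. h \<in> hom C Q ?P \<and> (\<forall>i\<in>{..<3}. ?p i \<cdot>\<^bsub>C\<^esub> h = q i)"
    if Q: "Q \<in> Ob C" and q: "\<forall>i\<in>{..<3}. q i \<in> hom C Q (?A i)" for Q and q :: "nat \<Rightarrow> 'b"
  proof -
    have q0: "q 0 \<in> hom C Q (pw a)" and q1: "q 1 \<in> hom C Q (pw b)" and q2: "q 2 \<in> hom C Q (pw c)"
      using q unfolding I by auto
    define r where "r j = (if j \<le> a then pr a j \<cdot>\<^bsub>C\<^esub> q 0 else if j \<le> a + b
      then pr b (j - a) \<cdot>\<^bsub>C\<^esub> q 1 else pr c (j - (a + b)) \<cdot>\<^bsub>C\<^esub> q 2)" for j
    have r: "r j \<in> hom C Q X" if "j \<in> {1..?n}" for j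
      unfolding r_def using that by (auto intro!: comp_hom[OF q0] comp_hom[OF q1] comp_hom[OF q2] prh)
    define h where "h = tuple C {1..?n} ?P (pr ?n) Q r"
    have h: "h \<in> hom C Q ?P" and hr: "\<And>j. j \<in> {1..?n} \<Longrightarrow> pr ?n j \<cdot>\<^bsub>C\<^esub> h = r j"
      unfolding h_def using tuple_props[OF pow[of ?n] Q, of r] r by simp_all
    have blk: "pr k j \<cdot>\<^bsub>C\<^esub> (block C pw pr ?n m k \<cdot>\<^bsub>C\<^esub> g) = pr ?n (m + j) \<cdot>\<^bsub>C\<^esub> g"
      if "j \<in> {1..k}" "m + k \<le> ?n" "g \<in> hom C Q ?P" for j k m g
      using comp_assoc[OF that(3) block_props(1)[OF assms that(2)] prh[OF that(1)]]
        block_props(2)[OF assms that(2,1)] by simp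
    have e0: "block C pw pr ?n 0 a \<cdot>\<^bsub>C\<^esub> h = q 0"
      by (rule product_eqI[OF pow assms(1) comp_hom[OF h h0] q0]) (auto simp: blk h hr r_def)
    have e1: "block C pw pr ?n a b \<cdot>\<^bsub>C\<^esub> h = q 1"
      by (rule product_eqI[OF pow assms(1) comp_hom[OF h h1] q1]) (auto simp: blk h hr r_def)
    have e2: "block C pw pr ?n (a + b) c \<cdot>\<^bsub>C\<^esub> h = q 2"
      by (rule product_eqI[OF pow assms(1) comp_hom[OF h h2] q2]) (auto simp: blk h hr r_def)
    have "g = h" if g: "g \<in> hom C Q ?P" and eq: "\<forall>i\<in>{..<3}. ?p i \<cdot>\<^bsub>C\<^esub> g = q i" for g
    proof (rule product_eqI[OF pow assms(1) g h])
      fix j assume j: "j \<in> {1..?n}"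
      have g0: "block C pw pr ?n 0 a \<cdot>\<^bsub>C\<^esub> g = q 0" and g1: "block C pw pr ?n a b \<cdot>\<^bsub>C\<^esub> g = q 1"
        and g2: "block C pw pr ?n (a + b) c \<cdot>\<^bsub>C\<^esub> g = q 2"
        using eq unfolding I by auto
      consider "j \<le> a" | "a < j" "j \<le> a + b" | "a + b < j" by linarith
      then show "pr ?n j \<cdot>\<^bsub>C\<^esub> g = pr ?n j \<cdot>\<^bsub>C\<^esub> h"
      proof cases
        case 1
        then show ?thesis using blk[of j a 0 g] blk[of j a 0 h] j g h e0 g0 by simp
      next
        case 2
        moreover have "j - a \<in> {1..b}" using 2 by simp arith
        ultimately show ?thesis using blk[of "j - a" b a g] blk[of "j - a" b a h] j g h e1 g1 by simp
      next
        case 3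
        moreover have "j - (a + b) \<in> {1..c}" using 3 j by simp arith
        ultimately show ?thesis
          using blk[of "j - (a + b)" c "a + b" g] blk[of "j - (a + b)" c "a + b" h] j g h e2 g2
          by simp
      qed
    qed
    note uniq = this
    show ?thesis
    proof (rule ex1I)
      show "h \<in> hom C Q ?P \<and> (\<forall>i\<in>{..<3}. ?p i \<cdot>\<^bsub>C\<^esub> h = q i)"
        unfolding I using h e0 e1 e2 by simp
    next
      fix g assume "g \<in> hom C Q ?P \<and> (\<forall>i\<in>{..<3}. ?p i \<cdot>\<^bsub>C\<^esub> g = q i)"
      then show "g = h" using uniq by blast
    qed
  qed
  moreover have "?P \<in> Ob C" using pow[of ?n] unfolding is_product_def by blast
  moreover have "\<forall>i\<in>{..<3}. ?p i \<in> hom C ?P (?A i)" unfolding I using h0 h1 h2 by simp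
  ultimately show ?thesis unfolding is_product_def by simp
qed

end

theory Submission
  imports Defs
begin

text \<open>The proof is the Yoneda lemma applied to an elementary fact about sets. A morphism
  \<open>f : X\<^sup>d \<rightarrow> X\<close> acts, for every object \<open>Q\<close>, on \<open>d\<close>-tuples of generalized elements
  \<open>x\<^sub>1, \<dots>, x\<^sub>d : Q \<rightarrow> X\<close> as the operation \<open>x \<mapsto> f \<circ> (x\<^sub>1, \<dots>, x\<^sub>d)\<close> on the set \<open>Hom(Q, X)\<close>. A morphism is
  invertible iff composition with it is bijective on generalized elements of every shape
  (\<open>is_iso_iff_bij_betw_hom\<close>). The composite of \<open>(Id, f)\<close> with the morphism discarding coordinate
  \<open>s \<le> d\<close> replaces the entry \<open>x\<^sub>s\<close> of a tuple by the value \<open>f(x)\<close>, up to the order of the entries, and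
  discarding coordinate \<open>d + 1\<close> gives the identity. So \<open>f\<close> belongs to the Latin maps iff each of its
  operations is Latin in the classical sense: with all but one argument held fixed, the value is a
  bijective function of the remaining argument (\<open>latin_maps_iff_latin_op\<close>).

  For operations on a set, closure under the operad structure is evident: the unit induces the
  identity, permuting the arguments only renames the one that varies, and in
  \<open>f(x\<^sub>1, \<dots>, g(x\<^sub>i, \<dots>), \<dots>)\<close> a single varying argument acts either through \<open>f\<close> alone or through a
  composite of two bijections, one coming from \<open>g\<close> and one from \<open>f\<close> (\<open>latin_op_partial_comp\<close>).\<close>

(* Rewriting 1 to Suc 0 would keep terms containing the index set {1..d} from matching. *)
declare One_nat_def [simp del]

section \<open>Latin operations on a set\<close>

text \<open>The arguments of an operation of arity \<open>d\<close> are the values of \<open>x\<close> at \<open>1, \<dots>, d\<close>. Encoding them by a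
  total function makes \<open>x(s := y)\<close> the tuple in which only argument \<open>s\<close> varies, and lets permuting and
  grouping of arguments be reindexing.\<close>

definition latin_op :: "'a set \<Rightarrow> nat \<Rightarrow> ((nat \<Rightarrow> 'a) \<Rightarrow> 'a) \<Rightarrow> bool" where
  "latin_op S d F \<longleftrightarrow>
     (\<forall>x \<in> {1..d} \<rightarrow> S. \<forall>s\<in>{1..d}. bij_betw (\<lambda>y. F (x(s := y))) S S)"

lemma latin_opD:
  "latin_op S d F \<Longrightarrow> x \<in> {1..d} \<rightarrow> S \<Longrightarrow> s \<in> {1..d} \<Longrightarrow> bij_betw (\<lambda>y. F (x(s := y))) S S"
  unfolding latin_op_def by blast

lemma latin_op_closed:
  assumes "latin_op S d F" "1 \<le> d" "x \<in> {1..d} \<rightarrow> S"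
  shows "F x \<in> S"
proof -
  have "bij_betw (\<lambda>y. F (x(1 := y))) S S"
    using latin_opD[OF assms(1,3), of 1] assms(2) by simp
  moreover have "x 1 \<in> S" using assms(2,3) by auto
  ultimately have "F (x(1 := x 1)) \<in> S" by (rule bij_betw_apply)
  then show ?thesis by simp
qed

lemma latin_op_cong:
  assumes "latin_op S d F" "\<And>x. x \<in> {1..d} \<rightarrow> S \<Longrightarrow> F x = G x"
  shows "latin_op S d G"
  unfolding latin_op_def
proof (intro ballI)
  fix x s assume x: "x \<in> {1..d} \<rightarrow> S" and s: "s \<in> {1..d}"
  have "F (x(s := y)) = G (x(s := y))" if "y \<in> S" for y
    using x that by (intro assms(2)) auto
  then show "bij_betw (\<lambda>y. G (x(s := y))) S S"
    using latin_opD[OF assms(1) x s] by (simp cong: bij_betw_cong)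
qed

lemma latin_op_permute:
  assumes F: "latin_op S d F" and \<sigma>: "\<sigma> permutes {1..d}"
  shows "latin_op S d (\<lambda>x. F (x \<circ> inv \<sigma>))"
  unfolding latin_op_def
proof (intro ballI)
  fix x s assume x: "x \<in> {1..d} \<rightarrow> S" and s: "s \<in> {1..d}"
  have "x(s := y) \<circ> inv \<sigma> = (x \<circ> inv \<sigma>)(\<sigma> s := y)" for y
    by (auto simp: fun_eq_iff permutes_inverses[OF \<sigma>] permutes_inv_eq[OF \<sigma>])
  moreover have "x \<circ> inv \<sigma> \<in> {1..d} \<rightarrow> S"
    using x permutes_in_image[OF permutes_inv[OF \<sigma>]] by fastforce
  moreover have "\<sigma> s \<in> {1..d}"
    using s permutes_in_image[OF \<sigma>] by blast
  ultimately show "bij_betw (\<lambda>y. F ((x(s := y)) \<circ> inv \<sigma>)) S S"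
    using latin_opD[OF F, of "x \<circ> inv \<sigma>" "\<sigma> s"] by simp
qed

text \<open>The arguments passed to the outer operation in \<open>f \<circ>\<^sub>i g\<close>, where \<open>G\<close> is the inner operation, of
  arity \<open>e\<close>.\<close>

definition partial_args :: "nat \<Rightarrow> nat \<Rightarrow> ((nat \<Rightarrow> 'a) \<Rightarrow> 'a) \<Rightarrow> (nat \<Rightarrow> 'a) \<Rightarrow> nat \<Rightarrow> 'a" where
  "partial_args e i G x j =
     (if j < i then x j else if j = i then G (\<lambda>k. x (i - 1 + k)) else x (j + e - 1))"

text \<open>If the varying argument \<open>s\<close> lies in the block \<open>i, \<dots>, i + e - 1\<close>, it acts through \<open>G\<close> and then
  through the \<open>i\<close>-th argument of \<open>F\<close>, which is a composite of bijections; otherwise the value of \<open>G\<close> is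
  constant and \<open>s\<close> acts through a single argument of \<open>F\<close>.\<close>

lemma latin_op_partial_comp:
  assumes F: "latin_op S d F" and G: "latin_op S e G" and e: "1 \<le> e" and i: "i \<in> {1..d}"
    and G_local: "\<And>x y. (\<And>j. j \<in> {1..e} \<Longrightarrow> x j = y j) \<Longrightarrow> G x = G y"
  shows "latin_op S (d + e - 1) (\<lambda>x. F (partial_args e i G x))"
  unfolding latin_op_def
proof (intro ballI)
  fix x s assume x: "x \<in> {1..d + e - 1} \<rightarrow> S" and s: "s \<in> {1..d + e - 1}"
  define a where "a = partial_args e i G x"
  have xi: "(\<lambda>k. x (i - 1 + k)) \<in> {1..e} \<rightarrow> S"
    using x i by (auto intro!: funcset_mem[OF x])
  have a: "a \<in> {1..d} \<rightarrow> S"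
    unfolding a_def partial_args_def using i e latin_op_closed[OF G e xi]
    by (auto intro!: funcset_mem[OF x]; arith)
  consider "s < i" | "i \<le> s" "s < i + e" | "i + e \<le> s" by linarith
  then show "bij_betw (\<lambda>y. F (partial_args e i G (x(s := y)))) S S"
  proof cases
    case 1
    have "G (\<lambda>k. (x(s := y)) (i - 1 + k)) = G (\<lambda>k. x (i - 1 + k))" for y
      using 1 by (intro G_local) auto
    then have "partial_args e i G (x(s := y)) = a(s := y)" for y
      unfolding a_def partial_args_def using 1 by (auto simp: fun_eq_iff)
    then show ?thesis using latin_opD[OF F a, of s] s i 1 by simp
  next
    case 2
    define b where "b = (\<lambda>k. x (i - 1 + k))"
    have "(\<lambda>k. (x(s := y)) (i - 1 + k)) = b(s - (i - 1) := y)" for y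
      unfolding b_def using 2 i by (auto simp: fun_eq_iff)
    note inner = this
    have args: "partial_args e i G (x(s := y)) = a(i := G (b(s - (i - 1) := y)))" for y
      unfolding a_def partial_args_def inner using 2 by (intro ext) (simp, arith?)
    have "bij_betw (\<lambda>y. G (b(s - (i - 1) := y))) S S"
      using 2 i xi unfolding b_def by (intro latin_opD[OF G]) auto
    then have "bij_betw ((\<lambda>w. F (a(i := w))) \<circ> (\<lambda>y. G (b(s - (i - 1) := y)))) S S"
      using latin_opD[OF F a i] by (rule bij_betw_trans)
    then show ?thesis by (simp add: args comp_def)
  next
    case 3
    have "G (\<lambda>k. (x(s := y)) (i - 1 + k)) = G (\<lambda>k. x (i - 1 + k))" for y
      using 3 i by (intro G_local) auto
    then have "partial_args e i G (x(s := y)) = a(s - (e - 1) := y)" for y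
      unfolding a_def partial_args_def using 3 e by (auto simp: fun_eq_iff)
    moreover have "s - (e - 1) \<in> {1..d}" using s 3 e i by auto
    ultimately show ?thesis using latin_opD[OF F a] by simp
  qed
qed

section \<open>Isomorphisms and generalized elements\<close>

lemma homD: "f \<in> hom C a b \<Longrightarrow> f \<in> Mor C \<and> Dom C f = a \<and> Cod C f = b"
  unfolding hom_def by simp

text \<open>Yoneda: a right inverse is a preimage of the identity, and it is also a left inverse because
  composition with \<open>u\<close> is injective.\<close>

lemma (in category) is_iso_iff_bij_betw_hom:
  assumes u: "u \<in> hom C A B"
  shows "is_iso C u \<longleftrightarrow> (\<forall>Q\<in>Ob C. bij_betw (\<lambda>h. u \<cdot>\<^bsub>C\<^esub> h) (hom C Q A) (hom C Q B))"
proof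
  assume "is_iso C u"
  then obtain v where v: "v \<in> hom C B A" and vu: "v \<cdot>\<^bsub>C\<^esub> u = Idt C A" and uv: "u \<cdot>\<^bsub>C\<^esub> v = Idt C B"
    unfolding is_iso_def using homD[OF u] by auto
  show "\<forall>Q\<in>Ob C. bij_betw (\<lambda>h. u \<cdot>\<^bsub>C\<^esub> h) (hom C Q A) (hom C Q B)"
  proof
    fix Q
    have "v \<cdot>\<^bsub>C\<^esub> (u \<cdot>\<^bsub>C\<^esub> h) = h" if "h \<in> hom C Q A" for h
      using comp_assoc[OF that u v] vu id_comp[OF that] by simp
    moreover have "u \<cdot>\<^bsub>C\<^esub> (v \<cdot>\<^bsub>C\<^esub> h) = h" if "h \<in> hom C Q B" for h
      using comp_assoc[OF that v u] uv id_comp[OF that] by simp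
    ultimately show "bij_betw (\<lambda>h. u \<cdot>\<^bsub>C\<^esub> h) (hom C Q A) (hom C Q B)"
      using comp_hom[OF _ u] comp_hom[OF _ v]
      by (intro bij_betw_byWitness[where f' = "\<lambda>h. v \<cdot>\<^bsub>C\<^esub> h"]) auto
  qed
next
  assume bij: "\<forall>Q\<in>Ob C. bij_betw (\<lambda>h. u \<cdot>\<^bsub>C\<^esub> h) (hom C Q A) (hom C Q B)"
  have A: "A \<in> Ob C" and B: "B \<in> Ob C" using homD[OF u] dom_ob cod_ob by auto
  have "Idt C B \<in> (\<lambda>h. u \<cdot>\<^bsub>C\<^esub> h) ` hom C B A"
    using bij B id_hom[OF B] unfolding bij_betw_def by blast
  then obtain v where v: "v \<in> hom C B A" and uv: "u \<cdot>\<^bsub>C\<^esub> v = Idt C B" by auto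
  have "u \<cdot>\<^bsub>C\<^esub> (v \<cdot>\<^bsub>C\<^esub> u) = u \<cdot>\<^bsub>C\<^esub> Idt C A"
    using comp_assoc[OF u v u] uv id_comp[OF u] comp_id[OF u] by simp
  moreover have "inj_on (\<lambda>h. u \<cdot>\<^bsub>C\<^esub> h) (hom C A A)"
    using bij A unfolding bij_betw_def by blast
  ultimately have "v \<cdot>\<^bsub>C\<^esub> u = Idt C A"
    using comp_hom[OF u v] id_hom[OF A] by (auto dest: inj_onD)
  then show "is_iso C u"
    unfolding is_iso_def using homD[OF u] v uv by auto
qed

section \<open>Tuples of generalized elements\<close>

locale object_powers = category C for C :: "('o, 'm) cat" (structure) +
  fixes X :: 'o and pw :: "nat \<Rightarrow> 'o" and pr :: "nat \<Rightarrow> nat \<Rightarrow> 'm"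
  assumes powers: "is_powers C X pw pr"
begin

abbreviation tup :: "nat \<Rightarrow> 'o \<Rightarrow> (nat \<Rightarrow> 'm) \<Rightarrow> 'm" where
  "tup d Q x \<equiv> tuple C {1..d} (pw d) (pr d) Q x"

lemma power_product: "is_product C {1..d} (\<lambda>_. X) (pw d) (pr d)"
  using powers unfolding is_powers_def by blast

lemma pw_ob: "pw d \<in> Ob C"
  using power_product[of d] unfolding is_product_def by blast

lemma pr_hom: "j \<in> {1..d} \<Longrightarrow> pr d j \<in> hom C (pw d) X"
  using power_product[of d] unfolding is_product_def by blast

lemma tup_hom: "Q \<in> Ob C \<Longrightarrow> x \<in> {1..d} \<rightarrow> hom C Q X \<Longrightarrow> tup d Q x \<in> hom C Q (pw d)"
  by (rule tuple_props(1)[OF power_product]) auto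

lemma pr_tup:
  "Q \<in> Ob C \<Longrightarrow> x \<in> {1..d} \<rightarrow> hom C Q X \<Longrightarrow> j \<in> {1..d} \<Longrightarrow> pr d j \<cdot> tup d Q x = x j"
  by (rule tuple_props(2)[OF power_product]) auto

lemma tup_cong: "(\<And>j. j \<in> {1..d} \<Longrightarrow> x j = y j) \<Longrightarrow> tup d Q x = tup d Q y"
  unfolding tuple_def by simp

lemma hom_power_eqI:
  "h \<in> hom C Q (pw d) \<Longrightarrow> k \<in> hom C Q (pw d) \<Longrightarrow>
    (\<And>j. j \<in> {1..d} \<Longrightarrow> pr d j \<cdot> h = pr d j \<cdot> k) \<Longrightarrow> h = k"
  by (rule product_eqI[OF power_product category_axioms])

lemma pr_comp_hom: "h \<in> hom C Q (pw d) \<Longrightarrow> (\<lambda>j. pr d j \<cdot> h) \<in> {1..d} \<rightarrow> hom C Q X"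
  using comp_hom[OF _ pr_hom] by blast

lemma hom_ob: "h \<in> hom C Q R \<Longrightarrow> Q \<in> Ob C"
  using dom_ob homD by metis

lemma tup_pr: "h \<in> hom C Q (pw d) \<Longrightarrow> tup d Q (\<lambda>j. pr d j \<cdot> h) = h"
  by (rule hom_power_eqI[OF tup_hom]) (simp_all only: pr_comp_hom pr_tup[OF _ pr_comp_hom] hom_ob)

lemma pr_comp_assoc:
  "h \<in> hom C Q R \<Longrightarrow> k \<in> hom C R (pw d) \<Longrightarrow> j \<in> {1..d} \<Longrightarrow> pr d j \<cdot> (k \<cdot> h) = (pr d j \<cdot> k) \<cdot> h"
  using comp_assoc[OF _ _ pr_hom] by metis

lemma comp_tup:
  assumes h: "h \<in> hom C Q R" and x: "x \<in> {1..d} \<rightarrow> hom C R X"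
  shows "tup d R x \<cdot> h = tup d Q (\<lambda>j. x j \<cdot> h)"
proof (rule hom_power_eqI)
  have R: "R \<in> Ob C" using homD[OF h] cod_ob by auto
  have xh: "(\<lambda>j. x j \<cdot> h) \<in> {1..d} \<rightarrow> hom C Q X" using comp_hom[OF h] x by blast
  show "tup d R x \<cdot> h \<in> hom C Q (pw d)" by (rule comp_hom[OF h tup_hom[OF R x]])
  show "tup d Q (\<lambda>j. x j \<cdot> h) \<in> hom C Q (pw d)" by (rule tup_hom[OF hom_ob[OF h] xh])
  show "pr d j \<cdot> (tup d R x \<cdot> h) = pr d j \<cdot> tup d Q (\<lambda>j. x j \<cdot> h)" if "j \<in> {1..d}" for j
    using pr_comp_assoc[OF h tup_hom[OF R x] that] pr_tup[OF R x that]
      pr_tup[OF hom_ob[OF h] xh that] by simp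
qed

section \<open>Latin maps are the morphisms inducing Latin operations\<close>

lemma graph_mor_eq_tup:
  assumes f: "f \<in> hom C (pw d) X"
  shows "graph_mor C pw pr d f = tup (d + 1) (pw d) (\<lambda>j. if j \<le> d then pr d j else f)"
proof -
  have blk: "block C pw pr (d + 1) 0 d \<in> hom C (pw (d + 1)) (pw d)"
    and pr_blk: "\<And>j. j \<in> {1..d} \<Longrightarrow> pr d j \<cdot> block C pw pr (d + 1) 0 d = pr (d + 1) j"
    using block_props[OF category_axioms powers, of 0 d "d + 1"] by auto
  have I: "{..<2::nat} = {0, 1}" by auto
  have "(\<forall>i\<in>{..<2}. [block C pw pr (d + 1) 0 d, pr (d + 1) (d + 1)] ! i \<cdot> h = [Idt C (pw d), f] ! i)
      \<longleftrightarrow> (\<forall>j\<in>{1..d + 1}. pr (d + 1) j \<cdot> h = (if j \<le> d then pr d j else f))"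
    (is "?L \<longleftrightarrow> ?R") if h: "h \<in> hom C (pw d) (pw (d + 1))" for h
  proof -
    have eq: "pr d j \<cdot> (block C pw pr (d + 1) 0 d \<cdot> h) = pr (d + 1) j \<cdot> h" if "j \<in> {1..d}" for j
      using pr_comp_assoc[OF h blk that] pr_blk[OF that] by simp
    have "block C pw pr (d + 1) 0 d \<cdot> h = Idt C (pw d) \<longleftrightarrow> (\<forall>j\<in>{1..d}. pr (d + 1) j \<cdot> h = pr d j)"
    proof
      assume "block C pw pr (d + 1) 0 d \<cdot> h = Idt C (pw d)"
      then show "\<forall>j\<in>{1..d}. pr (d + 1) j \<cdot> h = pr d j"
        using eq comp_id[OF pr_hom] by metis
    next
      assume "\<forall>j\<in>{1..d}. pr (d + 1) j \<cdot> h = pr d j"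
      then show "block C pw pr (d + 1) 0 d \<cdot> h = Idt C (pw d)"
        by (intro hom_power_eqI[OF comp_hom[OF h blk] id_hom[OF pw_ob]])
          (simp add: eq comp_id[OF pr_hom])
    qed
    moreover have "{1..d + 1} = insert (d + 1) {1..d}" by auto
    ultimately show ?thesis unfolding I by auto
  qed
  then have "(h \<in> hom C (pw d) (pw (d + 1)) \<and> (\<forall>i\<in>{..<2}.
        [block C pw pr (d + 1) 0 d, pr (d + 1) (d + 1)] ! i \<cdot> h = [Idt C (pw d), f] ! i))
      \<longleftrightarrow> (h \<in> hom C (pw d) (pw (d + 1)) \<and>
        (\<forall>j\<in>{1..d + 1}. pr (d + 1) j \<cdot> h = (if j \<le> d then pr d j else f)))" for h
    by blast
  then show ?thesis unfolding graph_mor_def tuple_def by simp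
qed

lemma discard_graph_mor:
  assumes f: "f \<in> hom C (pw d) X" and s: "s \<in> {1..d + 1}"
  shows "graph_mor C pw pr d f \<in> hom C (pw d) (pw (d + 1))"
    and "discard C pw pr d s \<cdot> graph_mor C pw pr d f =
      tup d (pw d) (\<lambda>j. if j < s then pr d j else if j < d then pr d (j + 1) else f)"
proof -
  have g: "(\<lambda>j. if j \<le> d then pr d j else f) \<in> {1..d + 1} \<rightarrow> hom C (pw d) X"
    using f pr_hom[of _ d] by auto
  then show h: "graph_mor C pw pr d f \<in> hom C (pw d) (pw (d + 1))"
    unfolding graph_mor_eq_tup[OF f] by (rule tup_hom[OF pw_ob])
  have "(\<lambda>j. pr (d + 1) (if j < s then j else j + 1)) \<in> {1..d} \<rightarrow> hom C (pw (d + 1)) X"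
    by (auto intro!: pr_hom)
  then have "discard C pw pr d s \<cdot> graph_mor C pw pr d f =
      tup d (pw d) (\<lambda>j. pr (d + 1) (if j < s then j else j + 1) \<cdot> graph_mor C pw pr d f)"
    unfolding discard_def by (rule comp_tup[OF h])
  also have "\<dots> = tup d (pw d) (\<lambda>j. if j < s then pr d j else if j < d then pr d (j + 1) else f)"
    unfolding graph_mor_eq_tup[OF f] using s by (intro tup_cong) (auto simp: pr_tup[OF pw_ob g])
  finally show "discard C pw pr d s \<cdot> graph_mor C pw pr d f =
      tup d (pw d) (\<lambda>j. if j < s then pr d j else if j < d then pr d (j + 1) else f)" .
qed

text \<open>The map on generalized elements of \<open>X\<^sup>d\<close> sends \<open>x\<close> to \<open>x\<close> without its \<open>s\<close>-th entry, followed by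
  \<open>f(x)\<close>. It preserves the entries other than \<open>s\<close>, so it is bijective iff it is bijective on each class
  of tuples that differ only at \<open>s\<close>.\<close>

lemma bij_betw_replace_iff:
  assumes f: "f \<in> hom C (pw d) X" and s: "s \<in> {1..d}" and Q: "Q \<in> Ob C"
    and u_def: "u = tup d (pw d) (\<lambda>j. if j < s then pr d j else if j < d then pr d (j + 1) else f)"
  shows "bij_betw (\<lambda>h. u \<cdot> h) (hom C Q (pw d)) (hom C Q (pw d)) \<longleftrightarrow>
    (\<forall>x \<in> {1..d} \<rightarrow> hom C Q X. bij_betw (\<lambda>y. f \<cdot> tup d Q (x(s := y))) (hom C Q X) (hom C Q X))"
    (is "?bij \<longleftrightarrow> _")
proof -
  let ?S = "hom C Q X" and ?P = "hom C Q (pw d)"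
  define r where "r x z j = (if j < s then x j else if j < d then x (j + 1) else z)"
    for x :: "nat \<Rightarrow> 'm" and z :: 'm and j
  have r: "r x z \<in> {1..d} \<rightarrow> ?S" if "x \<in> {1..d} \<rightarrow> ?S" "z \<in> ?S" for x z
    using that unfolding r_def by (auto intro!: funcset_mem[OF that(1)])
  have u: "u \<cdot> tup d Q x = tup d Q (r x (f \<cdot> tup d Q x))" if x: "x \<in> {1..d} \<rightarrow> ?S" for x
  proof -
    have "(\<lambda>j. if j < s then pr d j else if j < d then pr d (j + 1) else f) \<in> {1..d} \<rightarrow> hom C (pw d) X"
      using f by (auto intro!: pr_hom)
    from comp_tup[OF tup_hom[OF Q x] this] show ?thesis
      unfolding u_def r_def using x by (auto intro!: tup_cong pr_tup[OF Q x])
  qed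
  have f_tup: "f \<cdot> tup d Q x \<in> ?S" if "x \<in> {1..d} \<rightarrow> ?S" for x
    using comp_hom[OF tup_hom[OF Q that] f] .
  have upd: "x(s := y) \<in> {1..d} \<rightarrow> ?S" if "x \<in> {1..d} \<rightarrow> ?S" "y \<in> ?S" for x y
    using that by auto
  have tup_inj: "x j = y j"
    if "tup d Q x = tup d Q y" "x \<in> {1..d} \<rightarrow> ?S" "y \<in> {1..d} \<rightarrow> ?S" "j \<in> {1..d}" for x y j
    using pr_tup[OF Q that(2,4)] pr_tup[OF Q that(3,4)] that(1) by simp
  have r_inj: "(\<forall>j\<in>{1..d}. j \<noteq> s \<longrightarrow> x j = x' j) \<and> z = z'"
    if eq: "tup d Q (r x z) = tup d Q (r x' z')" and x: "x \<in> {1..d} \<rightarrow> ?S" "x' \<in> {1..d} \<rightarrow> ?S"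
      and z: "z \<in> ?S" "z' \<in> ?S" for x x' z z'
  proof -
    have rj: "r x z j = r x' z' j" if "j \<in> {1..d}" for j
      using tup_inj[OF eq r r that] x z by blast
    have "x j = x' j" if "j \<in> {1..d}" "j \<noteq> s" for j
    proof (cases "j < s")
      case True
      then show ?thesis using rj[OF that(1)] unfolding r_def by simp
    next
      case False
      then have "j - 1 \<in> {1..d}" "\<not> j - 1 < s" "j - 1 < d" "j - 1 + 1 = j" using that s by auto
      then show ?thesis using rj[of "j - 1"] unfolding r_def by simp
    qed
    moreover have "z = z'" using rj[of d] s unfolding r_def by auto
    ultimately show ?thesis by blast
  qed
  have r_upd: "r (x(s := y)) z = r x z" for x y z
    unfolding r_def by (auto simp: fun_eq_iff)
  show ?thesis
  proof
    assume bij: ?bij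
    show "\<forall>x \<in> {1..d} \<rightarrow> ?S. bij_betw (\<lambda>y. f \<cdot> tup d Q (x(s := y))) ?S ?S"
    proof
      fix x assume x: "x \<in> {1..d} \<rightarrow> ?S"
      show "bij_betw (\<lambda>y. f \<cdot> tup d Q (x(s := y))) ?S ?S"
      proof (rule bij_betw_imageI)
        show "inj_on (\<lambda>y. f \<cdot> tup d Q (x(s := y))) ?S"
        proof (rule inj_onI)
          fix y y' assume y: "y \<in> ?S" "y' \<in> ?S"
            and eq: "f \<cdot> tup d Q (x(s := y)) = f \<cdot> tup d Q (x(s := y'))"
          then have "u \<cdot> tup d Q (x(s := y)) = u \<cdot> tup d Q (x(s := y'))"
            using u[OF upd[OF x]] by (simp add: r_upd)
          then have "tup d Q (x(s := y)) = tup d Q (x(s := y'))"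
            using bij tup_hom[OF Q upd[OF x]] y unfolding bij_betw_def by (auto dest: inj_onD)
          from tup_inj[OF this upd[OF x] upd[OF x] s] y show "y = y'" by simp
        qed
        have "z \<in> (\<lambda>y. f \<cdot> tup d Q (x(s := y))) ` ?S" if z: "z \<in> ?S" for z
        proof -
          obtain h where h: "h \<in> ?P" and uh: "u \<cdot> h = tup d Q (r x z)"
            using bij tup_hom[OF Q r[OF x z]] unfolding bij_betw_def by (metis imageE)
          define x' where "x' j = pr d j \<cdot> h" for j
          have x': "x' \<in> {1..d} \<rightarrow> ?S" and h_eq: "h = tup d Q x'"
            unfolding x'_def using pr_comp_hom[OF h] tup_pr[OF h] by auto
          have "(\<forall>j\<in>{1..d}. j \<noteq> s \<longrightarrow> x' j = x j) \<and> f \<cdot> tup d Q x' = z"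
            using r_inj[OF _ x' x f_tup[OF x'] z] u[OF x'] uh h_eq by simp
          moreover from this have "tup d Q x' = tup d Q (x(s := x' s))"
            by (intro tup_cong) auto
          moreover have "x' s \<in> ?S" using x' s by blast
          ultimately show ?thesis by (metis image_eqI)
        qed
        then show "(\<lambda>y. f \<cdot> tup d Q (x(s := y))) ` ?S = ?S"
          using f_tup[OF upd[OF x]] by blast
      qed
    qed
  next
    assume lat: "\<forall>x \<in> {1..d} \<rightarrow> ?S. bij_betw (\<lambda>y. f \<cdot> tup d Q (x(s := y))) ?S ?S"
    have u_hom: "u \<cdot> h \<in> ?P" if "h \<in> ?P" for h
      using u[OF pr_comp_hom[OF that]] tup_pr[OF that]
        tup_hom[OF Q r[OF pr_comp_hom[OF that] f_tup[OF pr_comp_hom[OF that]]]] by simp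
    show ?bij
    proof (rule bij_betw_imageI)
      show "inj_on (\<lambda>h. u \<cdot> h) ?P"
      proof (rule inj_onI)
        fix h h' assume h: "h \<in> ?P" and h': "h' \<in> ?P" and eq: "u \<cdot> h = u \<cdot> h'"
        define x where "x j = pr d j \<cdot> h" for j
        define x' where "x' j = pr d j \<cdot> h'" for j
        have x: "x \<in> {1..d} \<rightarrow> ?S" and h_eq: "h = tup d Q x"
          unfolding x_def using pr_comp_hom[OF h] tup_pr[OF h] by auto
        have x': "x' \<in> {1..d} \<rightarrow> ?S" and h'_eq: "h' = tup d Q x'"
          unfolding x'_def using pr_comp_hom[OF h'] tup_pr[OF h'] by auto
        have same: "(\<forall>j\<in>{1..d}. j \<noteq> s \<longrightarrow> x j = x' j) \<and> f \<cdot> tup d Q x = f \<cdot> tup d Q x'"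
          using r_inj[OF _ x x' f_tup[OF x] f_tup[OF x']] u[OF x] u[OF x'] eq h_eq h'_eq by simp
        then have x'_upd: "tup d Q x' = tup d Q (x(s := x' s))"
          by (intro tup_cong) auto
        have "x s = x' s"
        proof (rule inj_onD)
          show "inj_on (\<lambda>y. f \<cdot> tup d Q (x(s := y))) ?S"
            using lat x unfolding bij_betw_def by blast
          show "f \<cdot> tup d Q (x(s := x s)) = f \<cdot> tup d Q (x(s := x' s))"
            using same x'_upd by simp
        qed (use x x' s in blast)+
        then show "h = h'" using h_eq h'_eq x'_upd by (metis fun_upd_triv)
      qed
      have "k \<in> (\<lambda>h. u \<cdot> h) ` ?P" if k: "k \<in> ?P" for k
      proof -
        define w where "w j = pr d j \<cdot> k" for j
        have w: "w \<in> {1..d} \<rightarrow> ?S" and k_eq: "k = tup d Q w"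
          unfolding w_def using pr_comp_hom[OF k] tup_pr[OF k] by auto
        \<comment> \<open>The entry of \<open>x\<close> at \<open>s\<close> is arbitrary and is corrected below.\<close>
        define x where "x j = w (if j \<le> s then j else j - 1)" for j
        have x: "x \<in> {1..d} \<rightarrow> ?S" unfolding x_def using s by (auto intro!: funcset_mem[OF w])
        have "w d \<in> ?S" using w s by auto
        then obtain y where y: "y \<in> ?S" and fy: "f \<cdot> tup d Q (x(s := y)) = w d"
          using lat x unfolding bij_betw_def by (metis (no_types, lifting) imageE)
        have "u \<cdot> tup d Q (x(s := y)) = tup d Q (r x (w d))"
          using u[OF upd[OF x y]] fy r_upd by simp
        also have "\<dots> = k"
          unfolding k_eq by (rule tup_cong) (auto simp: r_def x_def)
        finally show ?thesis using tup_hom[OF Q upd[OF x y]] by blast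
      qed
      then show "(\<lambda>h. u \<cdot> h) ` ?P = ?P" using u_hom by blast
    qed
  qed
qed

lemma latin_maps_iff_latin_op:
  "f \<in> latin_maps C X pw pr d \<longleftrightarrow>
    f \<in> hom C (pw d) X \<and> (\<forall>Q\<in>Ob C. latin_op (hom C Q X) d (\<lambda>x. f \<cdot> tup d Q x))"
proof (cases "f \<in> hom C (pw d) X")
  case False
  then show ?thesis unfolding latin_maps_def by simp
next
  case f: True
  let ?g = "graph_mor C pw pr d f"
  let ?u = "\<lambda>s. tup d (pw d) (\<lambda>j. if j < s then pr d j else if j < d then pr d (j + 1) else f)"
  have "?u (d + 1) = tup d (pw d) (\<lambda>j. pr d j \<cdot> Idt C (pw d))"
    by (intro tup_cong) (simp add: comp_id[OF pr_hom])
  then have "?u (d + 1) = Idt C (pw d)"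
    using tup_pr[OF id_hom[OF pw_ob]] by simp
  then have last: "is_iso C (?u (d + 1))"
    unfolding is_iso_def
    using homD[OF id_hom[OF pw_ob, of d]] id_hom[OF pw_ob, of d] id_comp[OF id_hom[OF pw_ob, of d]]
    by auto
  have iso: "is_iso C (?u s) \<longleftrightarrow> (\<forall>Q\<in>Ob C. \<forall>x \<in> {1..d} \<rightarrow> hom C Q X.
      bij_betw (\<lambda>y. f \<cdot> tup d Q (x(s := y))) (hom C Q X) (hom C Q X))" if s: "s \<in> {1..d}" for s
  proof -
    have "?u s \<in> hom C (pw d) (pw d)"
      using f by (intro tup_hom[OF pw_ob]) (auto intro!: pr_hom)
    then show ?thesis
      using is_iso_iff_bij_betw_hom bij_betw_replace_iff[OF f s _ refl] by simp
  qed
  have "f \<in> latin_maps C X pw pr d \<longleftrightarrow> (\<forall>s\<in>{1..d + 1}. is_iso C (discard C pw pr d s \<cdot> ?g))"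
    unfolding latin_maps_def latin_hypercube_def
    using f homD[OF discard_graph_mor(1)[OF f, of 1]] by simp
  also have "\<dots> \<longleftrightarrow> (\<forall>s\<in>{1..d + 1}. is_iso C (?u s))"
    by (intro ball_cong refl) (simp only: discard_graph_mor(2)[OF f])
  also have "\<dots> \<longleftrightarrow> (\<forall>s\<in>{1..d}. is_iso C (?u s))"
  proof -
    have "{1..d + 1} = insert (d + 1) {1..d}" by auto
    then show ?thesis using last by (simp only: ball_simps simp_thms)
  qed
  also have "\<dots> \<longleftrightarrow> (\<forall>Q\<in>Ob C. latin_op (hom C Q X) d (\<lambda>x. f \<cdot> tup d Q x))"
    unfolding latin_op_def using iso by (auto simp del: atLeastAtMost_iff)
  finally show ?thesis using f by simp
qed

section \<open>Closure under the operad structure\<close>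

lemma Idt_in_latin_maps: "Idt C X \<in> latin_maps C X pw pr 1"
proof -
  have X: "pw 1 = X" "pr 1 1 = Idt C X" using powers unfolding is_powers_def by auto
  have id: "Idt C X \<in> hom C (pw 1) X" using id_hom[OF pw_ob[of 1]] X by simp
  have "latin_op (hom C Q X) 1 (\<lambda>x. Idt C X \<cdot> tup 1 Q x)" if Q: "Q \<in> Ob C" for Q
  proof (rule latin_op_cong)
    show "latin_op (hom C Q X) 1 (\<lambda>x. x 1)"
      unfolding latin_op_def by (simp add: bij_betw_def)
    show "x 1 = Idt C X \<cdot> tup 1 Q x" if "x \<in> {1..1} \<rightarrow> hom C Q X" for x
      using pr_tup[OF Q that, of 1] X by simp
  qed
  then show ?thesis unfolding latin_maps_iff_latin_op using id by blast
qed

lemma perm_in_latin_maps: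
  assumes f: "f \<in> latin_maps C X pw pr n" and \<sigma>: "\<sigma> permutes {1..n}"
  shows "f \<cdot> perm_mor C pw pr n \<sigma> \<in> latin_maps C X pw pr n"
proof -
  have f_hom: "f \<in> hom C (pw n) X" using f unfolding latin_maps_def by simp
  have inv_in: "inv \<sigma> j \<in> {1..n}" if "j \<in> {1..n}" for j
    using that permutes_in_image[OF permutes_inv[OF \<sigma>]] by blast
  have p: "(\<lambda>j. pr n (inv \<sigma> j)) \<in> {1..n} \<rightarrow> hom C (pw n) X"
    using inv_in pr_hom by blast
  have p_hom: "perm_mor C pw pr n \<sigma> \<in> hom C (pw n) (pw n)"
    unfolding perm_mor_def by (rule tup_hom[OF pw_ob p])
  have "latin_op (hom C Q X) n (\<lambda>x. (f \<cdot> perm_mor C pw pr n \<sigma>) \<cdot> tup n Q x)"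
    if Q: "Q \<in> Ob C" for Q
  proof (rule latin_op_cong)
    show "latin_op (hom C Q X) n (\<lambda>x. f \<cdot> tup n Q (x \<circ> inv \<sigma>))"
      using f Q latin_op_permute[OF _ \<sigma>] unfolding latin_maps_iff_latin_op by blast
    fix x assume x: "x \<in> {1..n} \<rightarrow> hom C Q X"
    have "perm_mor C pw pr n \<sigma> \<cdot> tup n Q x = tup n Q (x \<circ> inv \<sigma>)"
      unfolding perm_mor_def comp_tup[OF tup_hom[OF Q x] p]
      by (rule tup_cong) (simp only: pr_tup[OF Q x inv_in] comp_def)
    then show "f \<cdot> tup n Q (x \<circ> inv \<sigma>) = (f \<cdot> perm_mor C pw pr n \<sigma>) \<cdot> tup n Q x"
      using comp_assoc[OF tup_hom[OF Q x] p_hom f_hom] by simp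
  qed
  then show ?thesis
    unfolding latin_maps_iff_latin_op using comp_hom[OF p_hom f_hom] by blast
qed

lemma block_tup:
  assumes "a + k \<le> n" "Q \<in> Ob C" and x: "x \<in> {1..n} \<rightarrow> hom C Q X"
  shows "block C pw pr n a k \<cdot> tup n Q x = tup k Q (\<lambda>j. x (a + j))"
proof -
  have "(\<lambda>j. pr n (a + j)) \<in> {1..k} \<rightarrow> hom C (pw n) X"
    using assms(1) by (auto intro!: pr_hom)
  from comp_tup[OF tup_hom[OF assms(2,3)] this] show ?thesis
    unfolding block_def using assms(1) by (auto intro!: tup_cong pr_tup[OF assms(2,3)])
qed

lemma insert_mor_eq_tup:
  assumes g: "g \<in> hom C (pw e) X" and e: "1 \<le> e" and i: "i \<in> {1..d}"
  shows "insert_mor C pw pr d e i g = tup d (pw (d + e - 1))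
    (\<lambda>j. if j < i then pr (d + e - 1) j else if j = i then g \<cdot> block C pw pr (d + e - 1) (i - 1) e
      else pr (d + e - 1) (j + e - 1))"
    (is "?h = tup d (pw ?n) ?q")
proof -
  note blk = block_props[OF category_axioms powers]
  note assms' = e i[simplified]
  define A where "A = (\<lambda>j. [pw (i - 1), pw 1, pw (d - i)] ! j)"
  define p where "p = (\<lambda>j. [block C pw pr d 0 (i - 1), pr d i, block C pw pr d i (d - i)] ! j)"
  define t where "t = (\<lambda>j. [Idt C (pw (i - 1)), g, Idt C (pw (d - i))] ! j \<cdot>
    [block C pw pr ?n 0 (i - 1), block C pw pr ?n (i - 1) e, block C pw pr ?n (i - 1 + e) (d - i)] ! j)"
  have I: "{..<3::nat} = {0, 1, 2}" by auto
  have dsum: "i + (d - i) = d" and isum: "i - 1 + 1 = i" using assms' by auto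
  have pr_i: "block C pw pr d (i - 1) 1 = pr d i"
    using block_one[OF category_axioms powers, of "i - 1" d] assms' isum by simp
  have prod: "is_product C {..<3} A (pw d) p"
    using blocks_product[OF category_axioms powers, of "i - 1" 1 "d - i"]
    unfolding A_def p_def dsum isum pr_i .
  have b0: "block C pw pr ?n 0 (i - 1) \<in> hom C (pw ?n) (pw (i - 1))"
    and b1: "block C pw pr ?n (i - 1) e \<in> hom C (pw ?n) (pw e)"
    and b2: "block C pw pr ?n (i - 1 + e) (d - i) \<in> hom C (pw ?n) (pw (d - i))"
    using assms' by (auto intro!: blk(1))
  have X: "pw 1 = X" using powers unfolding is_powers_def by auto
  have gb: "g \<cdot> block C pw pr ?n (i - 1) e \<in> hom C (pw ?n) X" by (rule comp_hom[OF b1 g])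
  have t_eq: "t 0 = block C pw pr ?n 0 (i - 1)" "t 1 = g \<cdot> block C pw pr ?n (i - 1) e"
      "t 2 = block C pw pr ?n (i - 1 + e) (d - i)"
    unfolding t_def using id_comp[OF b0] id_comp[OF b2] by simp_all
  have t: "t j \<in> hom C (pw ?n) (A j)" if "j \<in> {..<3}" for j
    using that b0 b2 gb X t_eq unfolding I A_def by auto
  have "?h = tuple C {..<3} (pw d) p (pw ?n) t"
    unfolding insert_mor_def prod_mor_def p_def t_def ..
  then have h: "?h \<in> hom C (pw ?n) (pw d)" and ph: "\<And>j. j \<in> {..<3} \<Longrightarrow> p j \<cdot> ?h = t j"
    using tuple_props[OF prod pw_ob t] by auto
  have h0: "block C pw pr d 0 (i - 1) \<cdot> ?h = block C pw pr ?n 0 (i - 1)"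
    and h1: "pr d i \<cdot> ?h = g \<cdot> block C pw pr ?n (i - 1) e"
    and h2: "block C pw pr d i (d - i) \<cdot> ?h = block C pw pr ?n (i - 1 + e) (d - i)"
    using ph[of 0] ph[of 1] ph[of 2] t_eq unfolding p_def by simp_all
  have q: "?q \<in> {1..d} \<rightarrow> hom C (pw ?n) X"
    using assms' gb by (auto intro!: pr_hom; arith)
  show ?thesis
  proof (rule hom_power_eqI[OF h tup_hom[OF pw_ob q]])
    fix j assume j: "j \<in> {1..d}"
    consider "j < i" | "j = i" | "i < j" by linarith
    then have "pr d j \<cdot> ?h = ?q j"
    proof cases
      case 1
      then have k: "j \<in> {1..i - 1}" "0 + (i - 1) \<le> d" "0 + (i - 1) \<le> ?n" using j assms' by auto
      show ?thesis
        using pr_comp_assoc[OF h blk(1)[OF k(2)] k(1)] blk(2)[OF k(2,1)] blk(2)[OF k(3,1)] h0 1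
        by simp
    next
      case 2
      then show ?thesis using h1 by simp
    next
      case 3
      then have k: "j - i \<in> {1..d - i}" "i + (d - i) \<le> d" "i - 1 + e + (d - i) \<le> ?n"
        using j assms' by auto
      have "i - 1 + e + (j - i) = j + e - 1" using 3 assms' by auto
      then show ?thesis
        using pr_comp_assoc[OF h blk(1)[OF k(2)] k(1)] blk(2)[OF k(2,1)] blk(2)[OF k(3,1)] h2 3
        by (simp add: add.commute)
    qed
    then show "pr d j \<cdot> ?h = pr d j \<cdot> tup d (pw ?n) ?q"
      using pr_tup[OF pw_ob q j] by simp
  qed
qed

text \<open>On generalized elements, \<open>Id \<times> g \<times> Id\<close> computes the arguments \<open>partial_args\<close> of the set-level
  partial composition.\<close>

lemma partial_comp_in_latin_maps:
  assumes f: "f \<in> latin_maps C X pw pr d" and g: "g \<in> latin_maps C X pw pr e"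
    and e: "1 \<le> e" and i: "i \<in> {1..d}"
  shows "f \<cdot> insert_mor C pw pr d e i g \<in> latin_maps C X pw pr (d + e - 1)"
proof -
  let ?n = "d + e - 1" and ?h = "insert_mor C pw pr d e i g"
  let ?b = "block C pw pr (d + e - 1) (i - 1) e"
  let ?q = "\<lambda>j. if j < i then pr ?n j else if j = i then g \<cdot> ?b else pr ?n (j + e - 1)"
  have f_hom: "f \<in> hom C (pw d) X" and g_hom: "g \<in> hom C (pw e) X"
    using f g unfolding latin_maps_def by auto
  have le: "i - 1 + e \<le> ?n" using i e by auto
  have b: "?b \<in> hom C (pw ?n) (pw e)" by (rule block_props(1)[OF category_axioms powers le])
  have q: "?q \<in> {1..d} \<rightarrow> hom C (pw ?n) X"
    using comp_hom[OF b g_hom] i e by (auto intro!: pr_hom; arith)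
  have h: "?h \<in> hom C (pw ?n) (pw d)"
    unfolding insert_mor_eq_tup[OF g_hom e i] by (rule tup_hom[OF pw_ob q])
  have "latin_op (hom C Q X) ?n (\<lambda>x. (f \<cdot> ?h) \<cdot> tup ?n Q x)" if Q: "Q \<in> Ob C" for Q
  proof (rule latin_op_cong)
    let ?G = "\<lambda>x. g \<cdot> tup e Q x"
    show "latin_op (hom C Q X) ?n (\<lambda>x. f \<cdot> tup d Q (partial_args e i ?G x))"
    proof (rule latin_op_partial_comp[OF _ _ e i])
      show "latin_op (hom C Q X) d (\<lambda>x. f \<cdot> tup d Q x)" "latin_op (hom C Q X) e ?G"
        using f g Q unfolding latin_maps_iff_latin_op by auto
      show "?G x = ?G y" if "\<And>j. j \<in> {1..e} \<Longrightarrow> x j = y j" for x y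
        using tup_cong[OF that] by simp
    qed
    fix x assume x: "x \<in> {1..?n} \<rightarrow> hom C Q X"
    have "?h \<cdot> tup ?n Q x = tup d Q (\<lambda>j. ?q j \<cdot> tup ?n Q x)"
      unfolding insert_mor_eq_tup[OF g_hom e i] by (rule comp_tup[OF tup_hom[OF Q x] q])
    also have "\<dots> = tup d Q (partial_args e i ?G x)"
    proof (rule tup_cong)
      fix j assume j: "j \<in> {1..d}"
      consider "j < i" | "j = i" | "i < j" by linarith
      then show "?q j \<cdot> tup ?n Q x = partial_args e i ?G x j"
      proof cases
        case 1
        then show ?thesis using pr_tup[OF Q x, of j] i j e by (simp add: partial_args_def)
      next
        case 2
        then show ?thesis
          using comp_assoc[OF tup_hom[OF Q x] b g_hom] block_tup[OF le Q x]
          by (simp add: partial_args_def)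
      next
        case 3
        then have "j + e - 1 \<in> {1..?n}" using j e by auto
        then show ?thesis using pr_tup[OF Q x] 3 by (simp add: partial_args_def)
      qed
    qed
    finally show "f \<cdot> tup d Q (partial_args e i ?G x) = (f \<cdot> ?h) \<cdot> tup ?n Q x"
      using comp_assoc[OF tup_hom[OF Q x] h f_hom] by simp
  qed
  then show ?thesis
    unfolding latin_maps_iff_latin_op using comp_hom[OF h f_hom] by blast
qed

lemma latin_maps_suboperad: "suboperad (endo_operad C X pw pr) (latin_maps C X pw pr)"
  unfolding suboperad_def endo_operad_def
  using Idt_in_latin_maps perm_in_latin_maps partial_comp_in_latin_maps
  by (simp add: latin_maps_def)

end

theorem theorem3p4:
  fixes C :: "('o, 'm) cat" and X :: 'o
    and pw :: "nat \<Rightarrow> 'o" and pr :: "nat \<Rightarrow> nat \<Rightarrow> 'm"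
  assumes "category C" and "has_finite_products C" and "X \<in> Ob C"
    and "is_powers C X pw pr"
  shows "(\<exists>L. suboperad (endo_operad C X pw pr) L \<and>
            (\<forall>d\<ge>1. L d = latin_maps C X pw pr d)) \<and>
         (\<forall>d e i f g. 1 \<le> d \<longrightarrow> 1 \<le> e \<longrightarrow> 1 \<le> i \<longrightarrow> i \<le> d \<longrightarrow>
            f \<in> latin_maps C X pw pr d \<longrightarrow> g \<in> latin_maps C X pw pr e \<longrightarrow>
            pcomp (endo_operad C X pw pr) d e i f g \<in> latin_maps C X pw pr (d + e - 1))"
proof -
  interpret object_powers C X pw pr
    using assms by (simp add: object_powers_def object_powers_axioms_def)
  have sub: "suboperad (endo_operad C X pw pr) (latin_maps C X pw pr)"
    by (rule latin_maps_suboperad)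
  then have "\<forall>d\<ge>1. \<forall>e\<ge>1. \<forall>i\<in>{1..d}. \<forall>f\<in>latin_maps C X pw pr d. \<forall>g\<in>latin_maps C X pw pr e.
      pcomp (endo_operad C X pw pr) d e i f g \<in> latin_maps C X pw pr (d + e - 1)"
    unfolding suboperad_def by blast
  then show ?thesis using sub by auto
qed

end
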